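(* Assume that $1\le q<\alpha<p\le\infty$ and that there exist a non-decreasing function $\varphi$ on $[0,\infty)$ and two constants $0<\mathfrak a\le\mathfrak b<\infty$ such that $$\mathfrak a\,\varphi(r)\le\mu(B(x,r))\le\mathfrak b\,\varphi(r),\qquad x\in X,\ r>0.$$ Then there is a constant $C>0$ such that $$\|f\|_{q,p,\alpha}\le C\,\|f\|^{*}_{\alpha,\infty}\qquad\text{for all } f\in L_0(X).$$
   Context: Setting. $(X,d,\mu)$ is a space of homogeneous type: $d$ is a quasi-metric on $X$ (with a constant $\kappa\ge 1$ such that $d(x,y)\le\kappa(d(x,z)+d(z,y))$ for all $x,y,z\in X$), and $\mu$ is a non-negative Borel measure such that, with $B(x,r)=\{y\in X: d(x,y)<r\}$, there is a constant $C$ with $0<\mu(B(x,2r))\le C\mu(B(x,r))<\infty$ for all $x\in X$, $r>0$. It is assumed moreover that all balls $B(x,r)$ are open for the $d$-topology, $(X,d)$ is separable, $\mu(X)=\infty$, and $B(x,R)\setminus B(x,r)\neq\emptyset$ for all $x\in X$ and $0<r<R<\infty$. Notation. $L_0(X)$ is the complex vector space of classes (modulo equality $\mu$-almost everywhere) of $\mu$-measurable complex-valued functions on $X$; $\|\cdot\|_q$ is the usual norm of $L^q(X)=L^q(X,\mu)$; $\chi_E$ is the characteristic function of $E$. For $f\in L_0(X)$ and $r>0$ (convention $1/\infty=0$), $${}_{r}\|f\|_{q,p,\alpha}=\left[\int_X\left(\mu(B(y,r))^{\frac1\alpha-\frac1p-\frac1q}\,\|f\chi_{B(y,r)}\|_q\right)^p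 d\mu(y)\right]^{1/p}\quad\text{if } p<\infty,$$ $${}_{r}\|f\|_{q,\infty,\alpha}=\sup_{y\in X}\mu(B(y,r))^{\frac1\alpha-\frac1q}\,\|f\chi_{B(y,r)}\|_q\quad\text{if } p=\infty,$$ and $\|f\|_{q,p,\alpha}=\sup_{r>0}\ {}_{r}\|f\|_{q,p,\alpha}\in[0,\infty]$. For $f\in L_0(X)$ put $\lambda_f(s)=\mu(\{x\in X:|f(x)|>s\})$ for $s>0$ and $f_*(t)=\inf\{s>0:\lambda_f(s)\le t\}$ for $t>0$. The weak-$L^\alpha$ quasi-norm is $\|f\|^{*}_{\alpha,\infty}=\sup_{t>0}t^{1/\alpha}f_*(t)=\sup_{s>0}s\,\lambda_f(s)^{1/\alpha}\in[0,\infty]$. *)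

theory Defs
  imports "HOL-Analysis.Analysis"
begin

subsection \<open>Spaces of homogeneous type\<close>

definition quasi_metric :: "'a set \<Rightarrow> ('a \<Rightarrow> 'a \<Rightarrow> real) \<Rightarrow> bool" where
  "quasi_metric X d \<longleftrightarrow>
     (\<forall>x\<in>X. \<forall>y\<in>X. 0 \<le> d x y) \<and>
     (\<forall>x\<in>X. \<forall>y\<in>X. d x y = 0 \<longleftrightarrow> x = y) \<and>
     (\<forall>x\<in>X. \<forall>y\<in>X. d x y = d y x) \<and>
     (\<exists>\<kappa>\<ge>1. \<forall>x\<in>X. \<forall>y\<in>X. \<forall>z\<in>X. d x y \<le> \<kappa> * (d x z + d z y))"

definition qball :: "'a set \<Rightarrow> ('a \<Rightarrow> 'a \<Rightarrow> real) \<Rightarrow> 'a \<Rightarrow> real \<Rightarrow> 'a set" where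
  "qball X d x r = {y \<in> X. d x y < r}"

text \<open>The \<open>d\<close>-topology. For a general quasi-metric the balls themselves need not be open in it.\<close>

definition qtopology :: "'a set \<Rightarrow> ('a \<Rightarrow> 'a \<Rightarrow> real) \<Rightarrow> 'a topology" where
  "qtopology X d = topology (\<lambda>U. U \<subseteq> X \<and> (\<forall>x\<in>U. \<exists>r>0. qball X d x r \<subseteq> U))"

lemma openin_qtopology:
  "openin (qtopology X d) U \<longleftrightarrow> U \<subseteq> X \<and> (\<forall>x\<in>U. \<exists>r>0. qball X d x r \<subseteq> U)"
proof -
  have "istopology (\<lambda>U. U \<subseteq> X \<and> (\<forall>x\<in>U. \<exists>r>0. qball X d x r \<subseteq> U))"
    unfolding istopology_def
  proof (intro conjI allI impI ballI)
    fix S T x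
    assume S: "S \<subseteq> X \<and> (\<forall>x\<in>S. \<exists>r>0. qball X d x r \<subseteq> S)"
      and T: "T \<subseteq> X \<and> (\<forall>x\<in>T. \<exists>r>0. qball X d x r \<subseteq> T)" and x: "x \<in> S \<inter> T"
    then obtain r s where rs: "r > 0" "qball X d x r \<subseteq> S" "s > 0" "qball X d x s \<subseteq> T"
      by blast
    then have "qball X d x (min r s) \<subseteq> S \<inter> T"
      by (auto simp: qball_def)
    with rs show "\<exists>r>0. qball X d x r \<subseteq> S \<inter> T"
      by (intro exI[of _ "min r s"]) auto
  next
    fix K x
    assume K: "\<forall>U\<in>K. U \<subseteq> X \<and> (\<forall>x\<in>U. \<exists>r>0. qball X d x r \<subseteq> U)" and x: "x \<in> \<Union>K"
    then obtain U where "U \<in> K" "x \<in> U" by blast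
    with K obtain r where "r > 0" "qball X d x r \<subseteq> U" by blast
    with \<open>U \<in> K\<close> show "\<exists>r>0. qball X d x r \<subseteq> \<Union>K" by blast
  qed blast+
  then show ?thesis
    by (simp add: qtopology_def topology_inverse')
qed

lemma topspace_qtopology: "topspace (qtopology X d) = X"
proof
  show "topspace (qtopology X d) \<subseteq> X"
    using openin_topspace[of "qtopology X d"] by (simp only: openin_qtopology)
  have "openin (qtopology X d) X"
    by (auto simp: openin_qtopology qball_def intro: exI[of _ 1])
  then show "X \<subseteq> topspace (qtopology X d)" by (rule openin_subset)
qed

text \<open>The underlying set \<open>X\<close> is \<open>space M\<close>.\<close>

locale homogeneous_type_space =
  fixes M :: "'a measure" and d :: "'a \<Rightarrow> 'a \<Rightarrow> real"
  assumes quasi_metric: "quasi_metric (space M) d"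
    and borel: "sets M = sigma_sets (space M) {U. openin (qtopology (space M) d) U}"
    and doubling: "\<exists>C::real. \<forall>x\<in>space M. \<forall>r>0.
          0 < emeasure M (qball (space M) d x (2 * r)) \<and>
          emeasure M (qball (space M) d x (2 * r)) \<le> ennreal C * emeasure M (qball (space M) d x r) \<and>
          ennreal C * emeasure M (qball (space M) d x r) < \<infinity>"
    and openin_qball: "\<And>x r. x \<in> space M \<Longrightarrow> 0 < r \<Longrightarrow>
          openin (qtopology (space M) d) (qball (space M) d x r)"
    and separable: "separable_space (qtopology (space M) d)"
    and infinite_measure: "emeasure M (space M) = \<infinity>"
    and annulus_nonempty: "\<And>x r R. x \<in> space M \<Longrightarrow> 0 < r \<Longrightarrow> r < R \<Longrightarrow>
          qball (space M) d x R - qball (space M) d x r \<noteq> {}"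

subsection \<open>Function spaces\<close>

text \<open>
  Representatives of the elements of \<open>L\<^sub>0(X)\<close>. The functionals below depend only on the class
  modulo equality almost everywhere. As \<open>\<mu>\<close>-measurability refers to the completion of \<open>\<mu>\<close>, they
  are all computed with respect to \<open>completion M\<close>.
\<close>

definition L0 :: "'a measure \<Rightarrow> ('a \<Rightarrow> complex) set" where
  "L0 M = borel_measurable (completion M)"

text \<open>Powers with exponent \<open>a > 0\<close> on \<open>[0,\<infinity>]\<close>; only such exponents are used.\<close>

definition epowr :: "ennreal \<Rightarrow> real \<Rightarrow> ennreal" where
  "epowr x a = (if x = \<infinity> then \<infinity> else ennreal (enn2real x powr a))"

definition Lq_norm :: "'a measure \<Rightarrow> real \<Rightarrow> ('a \<Rightarrow> complex) \<Rightarrow> ennreal" where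
  "Lq_norm M q f =
     epowr (\<integral>\<^sup>+ x. ennreal (norm (f x) powr q) \<partial>completion M) (1 / q)"

definition amalgam_norm_at ::
  "'a measure \<Rightarrow> ('a \<Rightarrow> 'a \<Rightarrow> real) \<Rightarrow> real \<Rightarrow> ennreal \<Rightarrow> real \<Rightarrow> real \<Rightarrow> ('a \<Rightarrow> complex) \<Rightarrow> ennreal"
where
  "amalgam_norm_at M d q p \<alpha> r f =
     (let B = (\<lambda>y. qball (space M) d y r);
          N = (\<lambda>y. Lq_norm M q (\<lambda>x. f x * indicator (B y) x))
      in if p = \<infinity>
         then (SUP y\<in>space M. ennreal (measure M (B y) powr (1 / \<alpha> - 1 / q)) * N y)
         else epowr (\<integral>\<^sup>+ y. epowr (ennreal (measure M (B y) powr (1 / \<alpha> - 1 / enn2real p - 1 / q)) * N y)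
                               (enn2real p) \<partial>completion M)
                    (1 / enn2real p))"

definition amalgam_norm ::
  "'a measure \<Rightarrow> ('a \<Rightarrow> 'a \<Rightarrow> real) \<Rightarrow> real \<Rightarrow> ennreal \<Rightarrow> real \<Rightarrow> ('a \<Rightarrow> complex) \<Rightarrow> ennreal" where
  "amalgam_norm M d q p \<alpha> f = (SUP r\<in>{0<..}. amalgam_norm_at M d q p \<alpha> r f)"

definition distribution_fun :: "'a measure \<Rightarrow> ('a \<Rightarrow> complex) \<Rightarrow> real \<Rightarrow> ennreal" where
  "distribution_fun M f s = emeasure (completion M) {x \<in> space M. norm (f x) > s}"

definition rearrangement :: "'a measure \<Rightarrow> ('a \<Rightarrow> complex) \<Rightarrow> real \<Rightarrow> ennreal" where
  "rearrangement M f t = (INF s\<in>{s. 0 < s \<and> distribution_fun M f s \<le> ennreal t}. ennreal s)"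

definition weak_norm :: "'a measure \<Rightarrow> real \<Rightarrow> ('a \<Rightarrow> complex) \<Rightarrow> ennreal" where
  "weak_norm M \<alpha> f = (SUP t\<in>{0<..}. ennreal (t powr (1 / \<alpha>)) * rearrangement M f t)"

end

theory Submission
  imports Defs
begin

text \<open>
  Fix a radius \<open>r\<close>. All balls \<open>B(y,r)\<close> have measure comparable to one number \<open>v\<close>, so up to constants
  the weight in the norm at scale \<open>r\<close> is a constant power of \<open>v\<close>, and for \<open>p < \<infinity>\<close> the claim becomes
  \<open>\<integral> (\<integral>\<^bsub>B(y,r)\<^esub> |f|\<^sup>q)\<^bsup>p/q\<^esup> d\<mu>(y) \<le> C w\<^sup>p v\<^bsup>1 + p/q - p/\<alpha>\<^esup>\<close>, where \<open>w\<close> bounds the weak norm, that is,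
  \<open>\<lambda>\<^sub>f(s) \<le> (w/s)\<^sup>\<alpha>\<close> for all \<open>s\<close>.

  The function is split at the height \<open>s\<^sub>0 = w v\<^bsup>-1/\<alpha>\<^esup>\<close>, at which the weak bound gives a superlevel set
  of measure at most \<open>v\<close>. Write \<open>m = p/q > 1\<close>.

  \<^item> The part above \<open>s\<^sub>0\<close> lies in \<open>L\<^sup>q(X)\<close> because \<open>q < \<alpha>\<close>. The \<open>m\<close>-th power of its integral over a
    ball is at most that integral times the \<open>(m-1)\<close>-st power of the integral over \<open>X\<close>.

  \<^item> The part below \<open>s\<^sub>0\<close> lies in \<open>L\<^sup>p(X)\<close> because \<open>p > \<alpha>\<close>. The power mean inequality on a ball replaces
    the \<open>m\<close>-th power of the integral of \<open>|f|\<^sup>q\<close> by \<open>v\<^bsup>m-1\<^esup>\<close> times the integral of \<open>|f|\<^sup>p\<close>.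

  Both bounds are linear in an integral over the ball, and by Tonelli integrating over the centres
  costs just one factor \<open>v\<close>. This is \<open>weak_type_slices_estimate\<close>. The norms over \<open>X\<close> of the
  two parts come from the weak bound by cutting into dyadic levels, which yields geometric series.
  For \<open>p = \<infinity>\<close> the claim is Kolmogorov's inequality, applied to each ball separately (\<open>kolmogorov_inequality\<close>).

  One point needs care. A quasi-metric need not be jointly measurable: open balls make
  \<open>{y. d x y < r}\<close> measurable for each \<open>x\<close>, but say nothing about \<open>{(x, y). d x y < r}\<close> in the product
  space. So Tonelli is applied to a larger relation, a countable union of products of balls around
  the points of a dense set, whose sections still lie in balls of a comparable radius
  (\<open>measurable_ball_relation\<close>). By doubling, the enlargement costs only a constant.
\<close>

section \<open>Powers of extended nonnegative reals\<close>

lemma epowr_ennreal: "0 \<le> x \<Longrightarrow> epowr (ennreal x) a = ennreal (x powr a)"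
  by (simp add: epowr_def)

lemma epowr_mono:
  assumes "0 < a" "x \<le> y"
  shows "epowr x a \<le> epowr y a"
proof (cases "y = \<infinity>")
  case True
  then show ?thesis by (simp add: epowr_def)
next
  case False
  with assms(2) have "x \<noteq> \<infinity>" by (auto simp: top_unique)
  moreover have "enn2real x \<le> enn2real y"
    using False assms(2) by (intro enn2real_mono) (auto simp: top.not_eq_extremum)
  ultimately show ?thesis
    using False assms(1) by (auto simp: epowr_def intro!: ennreal_leI powr_mono2)
qed

lemma epowr_epowr: "epowr (epowr x a) b = epowr x (a * b)"
  by (auto simp: epowr_def powr_powr)

lemma epowr_cmult:
  assumes "0 < c"
  shows "epowr (ennreal c * x) a = ennreal (c powr a) * epowr x a"
proof (cases x)
  case (real y)
  then show ?thesis
    using assms by (simp add: epowr_ennreal powr_mult flip: ennreal_mult)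
next
  case top
  with assms show ?thesis
    by (simp add: epowr_def ennreal_mult_top)
qed

lemma epowr_add_le:
  assumes "0 < a"
  shows "epowr (x + y) a \<le> ennreal (2 powr a) * (epowr x a + epowr y a)"
proof -
  have "epowr (x + y) a \<le> epowr (ennreal 2 * max x y) a"
  proof (rule epowr_mono[OF assms])
    have "x + y \<le> max x y + max x y" by (intro add_mono) auto
    then show "x + y \<le> ennreal 2 * max x y" by (simp add: mult_2)
  qed
  also have "\<dots> = ennreal (2 powr a) * epowr (max x y) a"
    by (rule epowr_cmult) simp
  also have "\<dots> \<le> ennreal (2 powr a) * (epowr x a + epowr y a)"
    by (intro mult_left_mono) (auto simp: max_def)
  finally show ?thesis .
qed

text \<open>
  Trading all but one of the powers of \<open>x\<close> for powers of an upper bound leaves an expression that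
  is linear in \<open>x\<close>. With \<open>x\<close> an integral over a ball, Tonelli then applies.
\<close>
lemma epowr_le_powr_mult:
  assumes "1 \<le> m" "0 \<le> S" "x \<le> ennreal S"
  shows "epowr x m \<le> ennreal (S powr (m - 1)) * x"
proof -
  obtain y where y: "x = ennreal y" "0 \<le> y" "y \<le> S"
    using assms by (cases x) (auto simp: top_unique)
  have "y powr m = y powr (m - 1) * y"
    using y(2) by (cases "y = 0") (auto simp: powr_diff)
  also have "\<dots> \<le> S powr (m - 1) * y"
    using y assms by (intro mult_right_mono powr_mono2) auto
  finally show ?thesis
    using y by (simp add: epowr_ennreal ennreal_leI flip: ennreal_mult)
qed

lemma borel_measurable_epowr [measurable (raw)]:
  assumes [measurable]: "g \<in> borel_measurable N"
  shows "(\<lambda>x. epowr (g x) a) \<in> borel_measurable N"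
  unfolding epowr_def by measurable

section \<open>The weak norm and the distribution function\<close>

text \<open>
  The weak norm is defined through the rearrangement, whereas the estimates use superlevel sets.
  If the measure of \<open>{|f| > s}\<close> exceeded some \<open>t > (w/s)\<^sup>\<alpha>\<close>, then \<open>f\<^sub>*(t) \<ge> s\<close>, and so
  \<open>t\<^bsup>1/\<alpha>\<^esup> f\<^sub>*(t) > w\<close>.
\<close>
lemma distribution_fun_le_if_weak_norm_le:
  assumes "weak_norm M \<alpha> f \<le> ennreal w" and "f \<in> L0 M" "0 < \<alpha>" "0 < w" "0 < s"
  shows "distribution_fun M f s \<le> ennreal ((w / s) powr \<alpha>)"
proof (rule ccontr)
  assume "\<not> ?thesis"
  then have "ennreal ((w / s) powr \<alpha>) < distribution_fun M f s" by simp
  then obtain t' where t': "ennreal ((w / s) powr \<alpha>) < t'" "t' < distribution_fun M f s"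
    using dense by blast
  then obtain t where t: "t' = ennreal t" "0 \<le> t" by (cases t') auto
  then have wt: "(w / s) powr \<alpha> < t" using t' by (simp add: ennreal_less_iff)
  have "0 < t" by (rule le_less_trans[OF powr_ge_zero wt])
  have s_le: "ennreal s \<le> rearrangement M f t"
    unfolding rearrangement_def
  proof (intro INF_greatest ennreal_leI, clarsimp)
    fix s' assume s': "0 < s'" "distribution_fun M f s' \<le> ennreal t"
    show "s \<le> s'"
    proof (rule ccontr)
      assume "\<not> s \<le> s'"
      have [measurable]: "f \<in> borel_measurable (completion M)" using assms by (simp add: L0_def)
      have "{x \<in> space (completion M). s' < norm (f x)} \<in> sets (completion M)" by measurable
      with \<open>\<not> s \<le> s'\<close> have "distribution_fun M f s \<le> distribution_fun M f s'"
        unfolding distribution_fun_def by (intro emeasure_mono) auto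
      with s' t' t show False by auto
    qed
  qed
  have "ennreal (t powr (1 / \<alpha>) * s) = ennreal (t powr (1 / \<alpha>)) * ennreal s"
    using \<open>0 < s\<close> by (simp add: ennreal_mult)
  also have "\<dots> \<le> ennreal (t powr (1 / \<alpha>)) * rearrangement M f t"
    by (intro mult_left_mono s_le) simp
  also have "\<dots> \<le> weak_norm M \<alpha> f"
    unfolding weak_norm_def using \<open>0 < t\<close> by (intro SUP_upper) auto
  also note assms(1)
  finally have "t powr (1 / \<alpha>) * s \<le> w" using \<open>0 < w\<close> by (simp add: ennreal_le_iff)
  then have "t powr (1 / \<alpha>) \<le> w / s" using \<open>0 < s\<close> by (simp add: field_simps)
  then have "(t powr (1 / \<alpha>)) powr \<alpha> \<le> (w / s) powr \<alpha>"
    using \<open>0 < \<alpha>\<close> by (intro powr_mono2) auto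
  with wt \<open>0 < t\<close> \<open>0 < \<alpha>\<close> show False by (simp add: powr_powr)
qed

section \<open>Integrals controlled by a weak-type bound\<close>

text \<open>
  A dyadic substitute for the layer cake formula: the integrand is dominated by a step function on
  the superlevel sets \<open>{u > \<sigma> k}\<close>, and the weak-type bound dominates the integrals of the steps by the
  terms of a geometric series.
\<close>
lemma nn_integral_le_geometric_superlevel:
  fixes u :: "'a \<Rightarrow> real" and c \<sigma> :: "nat \<Rightarrow> real"
  assumes u [measurable]: "u \<in> borel_measurable N"
    and weak: "\<And>s. 0 < s \<Longrightarrow> emeasure N {x \<in> space N. s < u x} \<le> ennreal ((w / s) powr \<alpha>)"
    and c: "\<And>k. 0 \<le> c k" and \<sigma>: "\<And>k. 0 < \<sigma> k"
    and geo: "\<And>k. c k * (w / \<sigma> k) powr \<alpha> = D * \<rho> ^ k"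
    and \<rho>: "0 \<le> \<rho>" "\<rho> < 1" and "0 \<le> D"
    and dom: "\<And>x. x \<in> space N \<Longrightarrow> h x = 0 \<or> (\<exists>k. \<sigma> k < u x \<and> h x \<le> ennreal (c k))"
  shows "(\<integral>\<^sup>+ x. h x \<partial>N) \<le> ennreal (D / (1 - \<rho>))"
proof -
  let ?I = "\<lambda>k. indicator {x \<in> space N. \<sigma> k < u x} :: 'a \<Rightarrow> ennreal"
  have "(\<integral>\<^sup>+ x. h x \<partial>N) \<le> (\<integral>\<^sup>+ x. (\<Sum>k. ennreal (c k) * ?I k x) \<partial>N)"
  proof (rule nn_integral_mono)
    fix x assume x: "x \<in> space N"
    show "h x \<le> (\<Sum>k. ennreal (c k) * ?I k x)"
    proof (cases "h x = 0")
      case False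
      with dom[OF x] obtain k where k: "\<sigma> k < u x" "h x \<le> ennreal (c k)" by blast
      note k(2)
      also have "ennreal (c k) = (\<Sum>j\<in>{k}. ennreal (c j) * ?I j x)"
        using k(1) x by simp
      also have "\<dots> \<le> (\<Sum>k. ennreal (c k) * ?I k x)"
        by (rule sum_le_suminf) (auto intro: summableI)
      finally show ?thesis .
    qed simp
  qed
  also have "\<dots> = (\<Sum>k. \<integral>\<^sup>+ x. ennreal (c k) * ?I k x \<partial>N)"
    by (rule nn_integral_suminf) measurable
  also have "\<dots> = (\<Sum>k. ennreal (c k) * emeasure N {x \<in> space N. \<sigma> k < u x})"
    by (subst nn_integral_cmult_indicator) auto
  also have "\<dots> \<le> (\<Sum>k. ennreal (D * \<rho> ^ k))"
  proof (intro suminf_le summableI)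
    fix k
    have "ennreal (c k) * emeasure N {x \<in> space N. \<sigma> k < u x}
        \<le> ennreal (c k) * ennreal ((w / \<sigma> k) powr \<alpha>)"
      by (intro mult_left_mono weak \<sigma>) simp
    also have "\<dots> = ennreal (D * \<rho> ^ k)"
      by (simp add: c geo flip: ennreal_mult)
    finally show "ennreal (c k) * emeasure N {x \<in> space N. \<sigma> k < u x} \<le> ennreal (D * \<rho> ^ k)" .
  qed
  also have "\<dots> = ennreal (D * (1 / (1 - \<rho>)))"
    using \<rho> \<open>0 \<le> D\<close>
    by (intro suminf_ennreal_eq sums_mult geometric_sums) auto
  finally show ?thesis by simp
qed

lemma nn_integral_powr_above_level_le:
  fixes u :: "'a \<Rightarrow> real"
  assumes u [measurable]: "u \<in> borel_measurable N"
    and weak: "\<And>s. 0 < s \<Longrightarrow> emeasure N {x \<in> space N. s < u x} \<le> ennreal ((w / s) powr \<alpha>)"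
    and "0 < q" "q < \<alpha>" "0 < w" "0 < s"
  shows "(\<integral>\<^sup>+ x. ennreal (u x powr q) * indicator {x. s < u x} x \<partial>N)
      \<le> ennreal (2 powr q / (1 - 2 powr (q - \<alpha>)) * (w powr \<alpha> * s powr (q - \<alpha>)))"
proof -
  define c where "c = (\<lambda>k::nat. (2 ^ Suc k * s) powr q)"
  define \<sigma> where "\<sigma> = (\<lambda>k::nat. 2 ^ k * s)"
  define D where "D = 2 powr q * (w powr \<alpha> * s powr (q - \<alpha>))"
  have "(\<integral>\<^sup>+ x. ennreal (u x powr q) * indicator {x. s < u x} x \<partial>N)
      \<le> ennreal (D / (1 - 2 powr (q - \<alpha>)))"
  proof (rule nn_integral_le_geometric_superlevel[OF u weak])
    show "0 \<le> c k" "0 < \<sigma> k" for k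
      using \<open>0 < s\<close> by (auto simp: c_def \<sigma>_def)
    \<comment> \<open>The series of steps has ratio \<open>2\<^bsup>q-\<alpha>\<^esup>\<close>: it converges exactly because \<open>q < \<alpha>\<close>.\<close>
    show "c k * (w / \<sigma> k) powr \<alpha> = D * (2 powr (q - \<alpha>)) ^ k" for k
    proof -
      have 1: "(2 ^ k * s) powr x = (2 powr x) ^ k * s powr x" for x
        using \<open>0 < s\<close> by (simp add: powr_mult powr_power powr_powr mult.commute flip: powr_realpow)
      have "c k = 2 powr q * ((2 powr q) ^ k * s powr q)"
        using \<open>0 < s\<close> by (simp add: c_def powr_mult mult.assoc flip: 1)
      moreover have "(w / \<sigma> k) powr \<alpha> = w powr \<alpha> / ((2 powr \<alpha>) ^ k * s powr \<alpha>)"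
        using \<open>0 < s\<close> \<open>0 < w\<close> by (simp add: \<sigma>_def powr_divide 1)
      ultimately show ?thesis
        by (simp add: D_def powr_diff power_divide mult_ac)
    qed
    show "2 powr (q - \<alpha>) < 1"
      using \<open>q < \<alpha>\<close> by (simp add: powr_less_one)
    fix x assume "x \<in> space N"
    show "ennreal (u x powr q) * indicator {x. s < u x} x = 0 \<or>
          (\<exists>k. \<sigma> k < u x \<and> ennreal (u x powr q) * indicator {x. s < u x} x \<le> ennreal (c k))"
    proof (cases "s < u x")
      case True
      then have t: "1 < u x / s" using \<open>0 < s\<close> by simp
      \<comment> \<open>The level \<open>k\<close> must satisfy \<open>2\<^sup>k s < u x \<le> 2\<^bsup>k+1\<^esup> s\<close>, strictly on the left, as superlevel sets
        are defined by a strict inequality.\<close>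
      define n where "n = (LEAST n. u x / s \<le> 2 ^ n)"
      obtain j where "u x / s < 2 ^ j" using real_arch_pow[of 2 "u x / s"] by auto
      then have n: "u x / s \<le> 2 ^ n"
        unfolding n_def by (rule LeastI[of "\<lambda>n. u x / s \<le> 2 ^ n", OF less_imp_le])
      with t obtain k where k: "n = Suc k" by (cases n) auto
      then have "2 ^ k < u x / s"
        using not_less_Least[of k "\<lambda>n. u x / s \<le> 2 ^ n"] by (auto simp: n_def)
      then have "\<sigma> k < u x" using \<open>0 < s\<close> by (simp add: \<sigma>_def field_simps)
      moreover have "u x powr q \<le> c k"
        unfolding c_def using n k \<open>0 < s\<close> \<open>0 < q\<close> True
        by (intro powr_mono2) (auto simp: field_simps)
      ultimately show ?thesis using True by (auto intro!: ennreal_leI)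
    qed simp
  qed (auto simp: D_def)
  then show ?thesis by (simp add: D_def)
qed

lemma nn_integral_powr_below_level_le:
  fixes u :: "'a \<Rightarrow> real"
  assumes u [measurable]: "u \<in> borel_measurable N" and nonneg: "\<And>x. 0 \<le> u x"
    and weak: "\<And>s. 0 < s \<Longrightarrow> emeasure N {x \<in> space N. s < u x} \<le> ennreal ((w / s) powr \<alpha>)"
    and "0 < \<alpha>" "\<alpha> < p" "0 < w" "0 < s"
  shows "(\<integral>\<^sup>+ x. ennreal (u x powr p) * indicator {x. u x \<le> s} x \<partial>N)
      \<le> ennreal (2 powr \<alpha> / (1 - 2 powr (\<alpha> - p)) * (w powr \<alpha> * s powr (p - \<alpha>)))"
proof -
  define c where "c = (\<lambda>k::nat. (s / 2 ^ k) powr p)"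
  define \<sigma> where "\<sigma> = (\<lambda>k::nat. s / 2 ^ Suc k)"
  define D where "D = 2 powr \<alpha> * (w powr \<alpha> * s powr (p - \<alpha>))"
  have "(\<integral>\<^sup>+ x. ennreal (u x powr p) * indicator {x. u x \<le> s} x \<partial>N)
      \<le> ennreal (D / (1 - 2 powr (\<alpha> - p)))"
  proof (rule nn_integral_le_geometric_superlevel[OF u weak])
    show "0 \<le> c k" "0 < \<sigma> k" for k
      using \<open>0 < s\<close> by (auto simp: c_def \<sigma>_def)
    \<comment> \<open>The levels descend from \<open>s\<close> to \<open>0\<close> and the ratio is \<open>2\<^bsup>\<alpha>-p\<^esup>\<close>: here \<open>p > \<alpha>\<close> is what
      gives convergence.\<close>
    show "c k * (w / \<sigma> k) powr \<alpha> = D * (2 powr (\<alpha> - p)) ^ k" for k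
    proof -
      have 1: "(2 ^ k :: real) powr x = (2 powr x) ^ k" for x
        by (simp add: powr_power powr_powr mult.commute flip: powr_realpow)
      have "c k = s powr p / (2 powr p) ^ k"
        using \<open>0 < s\<close> by (simp add: c_def powr_divide flip: 1)
      moreover have "(w / \<sigma> k) powr \<alpha> = w powr \<alpha> * (2 powr \<alpha> * (2 powr \<alpha>) ^ k) / s powr \<alpha>"
        using \<open>0 < s\<close> \<open>0 < w\<close> by (simp add: \<sigma>_def powr_divide powr_mult 1)
      ultimately show ?thesis
        by (simp add: D_def powr_diff power_divide mult_ac)
    qed
    show "2 powr (\<alpha> - p) < 1"
      using \<open>\<alpha> < p\<close> by (simp add: powr_less_one)
    fix x assume "x \<in> space N"
    show "ennreal (u x powr p) * indicator {x. u x \<le> s} x = 0 \<or>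
          (\<exists>k. \<sigma> k < u x \<and> ennreal (u x powr p) * indicator {x. u x \<le> s} x \<le> ennreal (c k))"
    proof (cases "u x \<le> s \<and> 0 < u x")
      case True
      then have t: "1 \<le> s / u x" using \<open>0 < s\<close> by simp
      define n where "n = (LEAST n. s / u x < 2 ^ n)"
      obtain j where "s / u x < 2 ^ j" using real_arch_pow[of 2 "s / u x"] by auto
      then have n: "s / u x < 2 ^ n"
        unfolding n_def by (rule LeastI)
      with t obtain k where k: "n = Suc k" by (cases n) auto
      then have "2 ^ k \<le> s / u x"
        using not_less_Least[of k "\<lambda>n. s / u x < 2 ^ n"] by (auto simp: n_def)
      then have "u x \<le> s / 2 ^ k" using True by (simp add: field_simps)
      then have "u x powr p \<le> c k"
        unfolding c_def using \<open>0 < \<alpha>\<close> \<open>\<alpha> < p\<close> True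
        by (intro powr_mono2) auto
      moreover have "\<sigma> k < u x"
        using n k True \<open>0 < s\<close> by (auto simp: \<sigma>_def field_simps)
      ultimately show ?thesis using True by (auto intro!: ennreal_leI)
    next
      case False
      with nonneg[of x] have "u x = 0 \<or> \<not> u x \<le> s" by auto
      then show ?thesis by auto
    qed
  qed (auto simp: D_def)
  then show ?thesis by (simp add: D_def)
qed

text \<open>
  Jensen's inequality for \<open>x\<^sup>m\<close> up to the factor \<open>2\<^sup>m\<close>. For every \<open>t > 0\<close>, \<open>g \<le> t + t\<^bsup>1-m\<^esup> g\<^sup>m\<close>: if
  \<open>g > t\<close>, the second term alone suffices. Let \<open>U\<close> be the integral of \<open>g\<close> over \<open>A\<close> and take \<open>t = U/(2v)\<close>.
  After integration the first term is at most \<open>U/2\<close> and, as \<open>U\<close> is finite, is absorbed into the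
  left-hand side.
\<close>
lemma nn_integral_power_mean_le:
  fixes g :: "'a \<Rightarrow> real"
  assumes g [measurable]: "g \<in> borel_measurable N" and nonneg: "\<And>x. 0 \<le> g x"
    and A [measurable]: "A \<in> sets N" and "emeasure N A \<le> ennreal v"
    and "0 < v" "1 \<le> m"
    and fin: "(\<integral>\<^sup>+ x. ennreal (g x) * indicator A x \<partial>N) < \<infinity>"
  shows "epowr (\<integral>\<^sup>+ x. ennreal (g x) * indicator A x \<partial>N) m
      \<le> ennreal (2 powr m * v powr (m - 1)) * (\<integral>\<^sup>+ x. ennreal (g x powr m) * indicator A x \<partial>N)"
proof -
  define I where "I = (\<integral>\<^sup>+ x. ennreal (g x powr m) * indicator A x \<partial>N)"
  obtain U where U: "(\<integral>\<^sup>+ x. ennreal (g x) * indicator A x \<partial>N) = ennreal U" "0 \<le> U"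
    using fin by (cases "\<integral>\<^sup>+ x. ennreal (g x) * indicator A x \<partial>N") auto
  have "ennreal (U powr m) \<le> ennreal (2 powr m * v powr (m - 1)) * I"
  proof (cases "U = 0 \<or> I = \<infinity>")
    case True
    then show ?thesis using \<open>0 < v\<close> by (auto simp: ennreal_mult_top)
  next
    case False
    then obtain J where J: "I = ennreal J" "0 \<le> J" by (cases I) auto
    define t where "t = U / (2 * v)"
    have "0 < t" using False U \<open>0 < v\<close> by (simp add: t_def)
    have pointwise: "g x \<le> t + t powr (1 - m) * g x powr m" for x
    proof (cases "g x \<le> t")
      case True
      then show ?thesis by (smt (verit) powr_ge_zero mult_nonneg_nonneg)
    next
      case False
      with \<open>0 < t\<close> have "0 < g x" by simp
      then have "g x = g x powr (1 - m) * g x powr m" by (simp flip: powr_add)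
      also have "\<dots> \<le> t powr (1 - m) * g x powr m"
        using False \<open>0 < t\<close> \<open>1 \<le> m\<close> by (intro mult_right_mono powr_mono2') auto
      finally show ?thesis using \<open>0 < t\<close> by simp
    qed
    have "ennreal U \<le> (\<integral>\<^sup>+ x. ennreal t * indicator A x +
        ennreal (t powr (1 - m)) * (ennreal (g x powr m) * indicator A x) \<partial>N)"
      unfolding U(1)[symmetric]
    proof (rule nn_integral_mono)
      fix x
      have "ennreal (g x) \<le> ennreal t + ennreal (t powr (1 - m)) * ennreal (g x powr m)"
        using pointwise[of x] \<open>0 < t\<close> by (simp flip: ennreal_mult ennreal_plus)
      then show "ennreal (g x) * indicator A x \<le> ennreal t * indicator A x +
        ennreal (t powr (1 - m)) * (ennreal (g x powr m) * indicator A x)"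
        by (cases "x \<in> A") auto
    qed
    also have "\<dots> = ennreal t * emeasure N A + ennreal (t powr (1 - m)) * I"
      unfolding I_def
      by (subst nn_integral_add) (auto simp: nn_integral_cmult nn_integral_cmult_indicator)
    also have "\<dots> \<le> ennreal t * ennreal v + ennreal (t powr (1 - m)) * I"
      by (intro add_mono mult_left_mono assms) auto
    also have "\<dots> = ennreal (t * v + t powr (1 - m) * J)"
      using \<open>0 < t\<close> \<open>0 < v\<close> J by (simp flip: ennreal_mult ennreal_plus)
    finally have "U \<le> t * v + t powr (1 - m) * J"
      using \<open>0 < t\<close> \<open>0 < v\<close> J by (subst (asm) ennreal_le_iff) auto
    moreover have Ut: "U = 2 * v * t" using \<open>0 < v\<close> by (simp add: t_def)
    ultimately have "v * t \<le> t powr (1 - m) * J" by (simp add: mult.commute)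
    then have "t powr (m - 1) * (v * t) \<le> t powr (m - 1) * (t powr (1 - m) * J)"
      by (intro mult_left_mono) auto
    also have "\<dots> = J" using \<open>0 < t\<close> by (simp flip: powr_add mult.assoc)
    also have "t powr (m - 1) * (v * t) = v * t powr m"
      using \<open>0 < t\<close> by (simp add: powr_diff)
    finally have vt: "v * t powr m \<le> J" .
    have "U powr m = 2 powr m * v powr (m - 1) * (v * t powr m)"
      using \<open>0 < t\<close> \<open>0 < v\<close> by (simp add: Ut powr_mult powr_diff)
    also have "\<dots> \<le> 2 powr m * v powr (m - 1) * J"
      using vt by (intro mult_left_mono) auto
    finally show ?thesis using J by (simp add: ennreal_leI flip: ennreal_mult)
  qed
  then show ?thesis using U by (simp add: I_def epowr_ennreal)
qed

text \<open>
  On a set of measure at most \<open>v\<close> the height \<open>s = w v\<^bsup>-1/\<alpha>\<^esup>\<close> balances the two contributions: where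
  \<open>u \<le> s\<close> the integral is at most \<open>s\<^sup>q v\<close>, and where \<open>u > s\<close> it is at most a multiple of
  \<open>w\<^sup>\<alpha> s\<^bsup>q-\<alpha>\<^esup>\<close>, which is the same quantity.
\<close>
lemma kolmogorov_inequality:
  fixes u :: "'a \<Rightarrow> real"
  assumes u [measurable]: "u \<in> borel_measurable N" and nonneg: "\<And>x. 0 \<le> u x"
    and weak: "\<And>s. 0 < s \<Longrightarrow> emeasure N {x \<in> space N. s < u x} \<le> ennreal ((w / s) powr \<alpha>)"
    and "0 < q" "q < \<alpha>" "0 < w"
    and A [measurable]: "A \<in> sets N" and "emeasure N A \<le> ennreal v" and "0 < v"
  shows "(\<integral>\<^sup>+ x. ennreal (u x powr q) * indicator A x \<partial>N)
      \<le> ennreal ((1 + 2 powr q / (1 - 2 powr (q - \<alpha>))) * (w powr q * v powr (1 - q / \<alpha>)))"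
proof -
  define s where "s = w * v powr (- 1 / \<alpha>)"
  define K where "K = 2 powr q / (1 - 2 powr (q - \<alpha>))"
  have "0 < s" using assms by (simp add: s_def)
  have "0 \<le> K" using \<open>q < \<alpha>\<close> by (simp add: K_def powr_less_one less_imp_le)
  have "0 < \<alpha>" using assms by simp
  have sq: "s powr q * v = w powr q * v powr (1 - q / \<alpha>)"
    using \<open>0 < w\<close> \<open>0 < v\<close>
    by (simp add: s_def powr_mult powr_divide powr_powr powr_diff powr_minus_divide)
  have sqa: "w powr \<alpha> * s powr (q - \<alpha>) = w powr q * v powr (1 - q / \<alpha>)"
    using \<open>0 < w\<close> \<open>0 < v\<close> \<open>0 < \<alpha>\<close>
    by (simp add: s_def powr_mult powr_divide powr_powr powr_diff powr_minus_divide diff_divide_distrib)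
  have "(\<integral>\<^sup>+ x. ennreal (u x powr q) * indicator A x \<partial>N) \<le>
     (\<integral>\<^sup>+ x. ennreal (s powr q) * indicator A x + ennreal (u x powr q) * indicator {x. s < u x} x \<partial>N)"
  proof (rule nn_integral_mono)
    fix x
    show "ennreal (u x powr q) * indicator A x
       \<le> ennreal (s powr q) * indicator A x + ennreal (u x powr q) * indicator {x. s < u x} x"
    proof (cases "s < u x")
      case False
      then have "u x powr q \<le> s powr q" using nonneg \<open>0 < q\<close> by (intro powr_mono2) auto
      then show ?thesis by (auto simp: indicator_def intro!: ennreal_leI)
    qed (auto simp: indicator_def)
  qed
  also have "\<dots> = ennreal (s powr q) * emeasure N A +
      (\<integral>\<^sup>+ x. ennreal (u x powr q) * indicator {x. s < u x} x \<partial>N)"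
    by (subst nn_integral_add) (auto simp: nn_integral_cmult_indicator)
  also have "\<dots> \<le> ennreal (s powr q) * ennreal v + ennreal (K * (w powr \<alpha> * s powr (q - \<alpha>)))"
    unfolding K_def using \<open>0 < s\<close> assms
    by (intro add_mono mult_left_mono nn_integral_powr_above_level_le) auto
  also have "\<dots> = ennreal (w powr q * v powr (1 - q / \<alpha>) + K * (w powr q * v powr (1 - q / \<alpha>)))"
    using \<open>0 \<le> K\<close> \<open>0 < v\<close> by (simp add: sqa sq flip: ennreal_mult ennreal_plus)
  also have "\<dots> = ennreal ((1 + K) * (w powr q * v powr (1 - q / \<alpha>)))"
    by (simp add: distrib_right)
  finally show ?thesis by (simp add: K_def)
qed

section \<open>Averaging over the sections of a measurable relation\<close>

text \<open>
  Tonelli: a point \<open>x\<close> is counted once for each \<open>y\<close> related to it, and these \<open>y\<close> fill a set of measure at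
  most \<open>v\<close>.
\<close>
lemma (in sigma_finite_measure) nn_integral_slices_le:
  assumes G [measurable]: "G \<in> sets (M \<Otimes>\<^sub>M M)"
    and slice: "\<And>x. x \<in> space M \<Longrightarrow> emeasure M {y \<in> space M. (y, x) \<in> G} \<le> v"
    and h [measurable]: "h \<in> borel_measurable M"
  shows "(\<integral>\<^sup>+ y. (\<integral>\<^sup>+ x. h x * indicator {x \<in> space M. (y, x) \<in> G} x \<partial>M) \<partial>M)
      \<le> v * (\<integral>\<^sup>+ x. h x \<partial>M)"
proof -
  interpret P: pair_sigma_finite M M ..
  have "(\<integral>\<^sup>+ y. (\<integral>\<^sup>+ x. h x * indicator {x \<in> space M. (y, x) \<in> G} x \<partial>M) \<partial>M)
      = (\<integral>\<^sup>+ y. (\<integral>\<^sup>+ x. h x * indicator G (y, x) \<partial>M) \<partial>M)"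
    by (intro nn_integral_cong) (auto simp: indicator_def)
  also have "\<dots> = (\<integral>\<^sup>+ x. (\<integral>\<^sup>+ y. h x * indicator G (y, x) \<partial>M) \<partial>M)"
    by (rule P.Fubini'[symmetric, of "\<lambda>y x. h x * indicator G (y, x)"]) simp
  also have "\<dots> \<le> (\<integral>\<^sup>+ x. v * h x \<partial>M)"
  proof (rule nn_integral_mono)
    fix x assume x: "x \<in> space M"
    have "(\<integral>\<^sup>+ y. h x * indicator G (y, x) \<partial>M)
        = (\<integral>\<^sup>+ y. h x * indicator {y \<in> space M. (y, x) \<in> G} y \<partial>M)"
      by (intro nn_integral_cong) (auto simp: indicator_def)
    also have "\<dots> = h x * emeasure M {y \<in> space M. (y, x) \<in> G}"
      using x by (intro nn_integral_cmult_indicator) measurable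
    also have "\<dots> \<le> h x * v" by (intro mult_left_mono slice x) simp
    finally show "(\<integral>\<^sup>+ y. h x * indicator G (y, x) \<partial>M) \<le> v * h x" by (simp add: mult.commute)
  qed
  also have "\<dots> = v * (\<integral>\<^sup>+ x. h x \<partial>M)" by (rule nn_integral_cmult) simp
  finally show ?thesis .
qed

text \<open>
  The case \<open>p < \<infinity>\<close> for an arbitrary measurable relation \<open>G\<close> in place of the relation "\<open>x\<close> lies in the
  ball around \<open>y\<close>". Only the measures of the sections of \<open>G\<close> matter: the sections in one direction
  enter through the power mean inequality, those in the other direction through Tonelli. In the
  proof, \<open>h\<close> is \<open>u\<^sup>q\<close> where \<open>u\<close> exceeds the height \<open>s\<close>, and \<open>g\<close> is \<open>u\<^sup>q\<close> elsewhere.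
\<close>
lemma (in sigma_finite_measure) weak_type_slices_estimate:
  fixes u :: "'a \<Rightarrow> real"
  assumes u [measurable]: "u \<in> borel_measurable M" and nonneg: "\<And>x. 0 \<le> u x"
    and weak: "\<And>s. 0 < s \<Longrightarrow> emeasure M {x \<in> space M. s < u x} \<le> ennreal ((w / s) powr \<alpha>)"
    and "0 < q" "q < \<alpha>" "\<alpha> < p" "0 < w" "0 < v"
    and G [measurable]: "G \<in> sets (M \<Otimes>\<^sub>M M)"
    and slice1: "\<And>y. y \<in> space M \<Longrightarrow> emeasure M {x \<in> space M. (y, x) \<in> G} \<le> ennreal v"
    and slice2: "\<And>x. x \<in> space M \<Longrightarrow> emeasure M {y \<in> space M. (y, x) \<in> G} \<le> ennreal v"
  shows "(\<integral>\<^sup>+ y. epowr (\<integral>\<^sup>+ x. ennreal (u x powr q) * indicator {x \<in> space M. (y, x) \<in> G} x \<partial>M) (p / q) \<partial>M)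
      \<le> ennreal (2 powr (p / q) * ((2 powr q / (1 - 2 powr (q - \<alpha>))) powr (p / q)
            + 2 powr (p / q) * (2 powr \<alpha> / (1 - 2 powr (\<alpha> - p))))
          * (w powr p * v powr (1 + p / q - p / \<alpha>)))"
proof -
  define m where "m = p / q"
  define s where "s = w * v powr (- 1 / \<alpha>)"
  define K where "K = 2 powr q / (1 - 2 powr (q - \<alpha>))"
  define L where "L = 2 powr \<alpha> / (1 - 2 powr (\<alpha> - p))"
  define A where "A = (\<lambda>y. {x \<in> space M. (y, x) \<in> G})"
  define g where "g = (\<lambda>x. if u x \<le> s then u x powr q else 0)"
  define h where "h = (\<lambda>x. if u x \<le> s then 0 else u x powr q)"
  define S where "S = K * (w powr q * v powr (1 - q / \<alpha>))"
  define T where "T = L * (w powr p * v powr (1 - p / \<alpha>))"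
  let ?H = "\<lambda>y. \<integral>\<^sup>+ x. ennreal (h x) * indicator (A y) x \<partial>M"
  let ?J = "\<lambda>y. \<integral>\<^sup>+ x. ennreal (g x) * indicator (A y) x \<partial>M"
  let ?I = "\<lambda>y. \<integral>\<^sup>+ x. ennreal (g x powr m) * indicator (A y) x \<partial>M"
  have "0 < \<alpha>" "0 < p" "0 < s" using assms by (auto simp: s_def)
  have "1 < m" and qm: "q * m = p" using assms by (auto simp: m_def)
  have "0 \<le> K" "0 \<le> L"
    using \<open>q < \<alpha>\<close> \<open>\<alpha> < p\<close> by (auto simp: K_def L_def powr_less_one less_imp_le)
  then have "0 \<le> S" "0 \<le> T" by (auto simp: S_def T_def)
  have [measurable]: "g \<in> borel_measurable M" "h \<in> borel_measurable M"
    unfolding g_def h_def by measurable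
  have g0: "0 \<le> g x" and h0: "0 \<le> h x" for x by (auto simp: g_def h_def)
  have As [measurable]: "A y \<in> sets M" if "y \<in> space M" for y
    unfolding A_def using that by measurable

  have hS: "(\<integral>\<^sup>+ x. ennreal (h x) \<partial>M) \<le> ennreal S"
  proof -
    have "(\<integral>\<^sup>+ x. ennreal (h x) \<partial>M) = (\<integral>\<^sup>+ x. ennreal (u x powr q) * indicator {x. s < u x} x \<partial>M)"
      by (intro nn_integral_cong) (auto simp: h_def indicator_def)
    also have "\<dots> \<le> ennreal (K * (w powr \<alpha> * s powr (q - \<alpha>)))"
      unfolding K_def using assms \<open>0 < s\<close> by (intro nn_integral_powr_above_level_le) auto
    also have "w powr \<alpha> * s powr (q - \<alpha>) = w powr q * v powr (1 - q / \<alpha>)"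
      using \<open>0 < w\<close> \<open>0 < v\<close> \<open>0 < \<alpha>\<close>
      by (simp add: s_def powr_mult powr_divide powr_powr powr_diff powr_minus_divide diff_divide_distrib)
    finally show ?thesis by (simp add: S_def)
  qed
  have gT: "(\<integral>\<^sup>+ x. ennreal (g x powr m) \<partial>M) \<le> ennreal T"
  proof -
    have "(\<integral>\<^sup>+ x. ennreal (g x powr m) \<partial>M)
        = (\<integral>\<^sup>+ x. ennreal (u x powr p) * indicator {x. u x \<le> s} x \<partial>M)"
      by (intro nn_integral_cong) (auto simp: g_def indicator_def powr_powr qm)
    also have "\<dots> \<le> ennreal (L * (w powr \<alpha> * s powr (p - \<alpha>)))"
      unfolding L_def using assms \<open>0 < s\<close> \<open>0 < \<alpha>\<close> by (intro nn_integral_powr_below_level_le) auto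
    also have "w powr \<alpha> * s powr (p - \<alpha>) = w powr p * v powr (1 - p / \<alpha>)"
      using \<open>0 < w\<close> \<open>0 < v\<close> \<open>0 < \<alpha>\<close>
      by (simp add: s_def powr_mult powr_divide powr_powr powr_diff powr_minus_divide diff_divide_distrib)
    finally show ?thesis by (simp add: T_def)
  qed

  have pointwise: "epowr (\<integral>\<^sup>+ x. ennreal (u x powr q) * indicator (A y) x \<partial>M) m
     \<le> ennreal (2 powr m) * (ennreal (S powr (m - 1)) * ?H y
          + ennreal (2 powr m * v powr (m - 1)) * ?I y)" if y: "y \<in> space M" for y
  proof -
    have "(\<integral>\<^sup>+ x. ennreal (u x powr q) * indicator (A y) x \<partial>M)
        = (\<integral>\<^sup>+ x. ennreal (h x) * indicator (A y) x + ennreal (g x) * indicator (A y) x \<partial>M)"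
      by (intro nn_integral_cong) (auto simp: g_def h_def)
    also have "\<dots> = ?H y + ?J y"
      using y by (intro nn_integral_add) auto
    finally have "epowr (\<integral>\<^sup>+ x. ennreal (u x powr q) * indicator (A y) x \<partial>M) m
        \<le> ennreal (2 powr m) * (epowr (?H y) m + epowr (?J y) m)"
      using \<open>1 < m\<close> by (simp add: epowr_add_le)
    also have "\<dots> \<le> ennreal (2 powr m) * (ennreal (S powr (m - 1)) * ?H y
          + ennreal (2 powr m * v powr (m - 1)) * ?I y)"
    proof (intro mult_left_mono add_mono)
      have "?H y \<le> (\<integral>\<^sup>+ x. ennreal (h x) \<partial>M)"
        by (intro nn_integral_mono) (auto simp: indicator_def)
      with hS show "epowr (?H y) m \<le> ennreal (S powr (m - 1)) * ?H y"
        using \<open>1 < m\<close> \<open>0 \<le> S\<close> by (intro epowr_le_powr_mult) auto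
      have "?J y \<le> (\<integral>\<^sup>+ x. ennreal (s powr q) * indicator (A y) x \<partial>M)"
        using \<open>0 < q\<close> nonneg
        by (intro nn_integral_mono mult_right_mono ennreal_leI)
           (auto simp: g_def intro!: powr_mono2)
      also have "\<dots> = ennreal (s powr q) * emeasure M (A y)"
        using y by (intro nn_integral_cmult_indicator) auto
      also have "\<dots> \<le> ennreal (s powr q) * ennreal v"
        unfolding A_def by (intro mult_left_mono slice1 y) simp
      also have "\<dots> < \<infinity>" by (simp add: ennreal_mult_less_top)
      finally show "epowr (?J y) m \<le> ennreal (2 powr m * v powr (m - 1)) * ?I y"
        using y \<open>1 < m\<close> \<open>0 < v\<close> slice1[OF y] g0
        by (intro nn_integral_power_mean_le) (auto simp: A_def)
    qed simp_all
    finally show ?thesis .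
  qed

  have meas: "(\<lambda>y. \<integral>\<^sup>+ x. k x * indicator (A y) x \<partial>M) \<in> borel_measurable M"
    if [measurable]: "k \<in> borel_measurable M" for k :: "'a \<Rightarrow> ennreal"
  proof -
    have "(\<lambda>y. \<integral>\<^sup>+ x. k x * indicator G (y, x) \<partial>M) \<in> borel_measurable M"
      by measurable
    then show ?thesis
      by (rule measurable_cong[THEN iffD1, rotated])
         (auto intro!: nn_integral_cong simp: A_def indicator_def)
  qed
  have [measurable]: "?H \<in> borel_measurable M" "?I \<in> borel_measurable M"
    by (intro meas; measurable)+
  have "(\<integral>\<^sup>+ y. epowr (\<integral>\<^sup>+ x. ennreal (u x powr q) * indicator (A y) x \<partial>M) m \<partial>M)
     \<le> (\<integral>\<^sup>+ y. ennreal (2 powr m) * (ennreal (S powr (m - 1)) * ?H y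
          + ennreal (2 powr m * v powr (m - 1)) * ?I y) \<partial>M)"
    by (intro nn_integral_mono pointwise)
  also have "\<dots> = ennreal (2 powr m) * (ennreal (S powr (m - 1)) * (\<integral>\<^sup>+ y. ?H y \<partial>M)
          + ennreal (2 powr m * v powr (m - 1)) * (\<integral>\<^sup>+ y. ?I y \<partial>M))"
    by (simp add: nn_integral_cmult nn_integral_add)
  also have "\<dots> \<le> ennreal (2 powr m) * (ennreal (S powr (m - 1)) * (ennreal v * ennreal S)
          + ennreal (2 powr m * v powr (m - 1)) * (ennreal v * ennreal T))"
  proof (intro mult_left_mono add_mono)
    show "(\<integral>\<^sup>+ y. ?H y \<partial>M) \<le> ennreal v * ennreal S"
      unfolding A_def
      by (rule order_trans[OF nn_integral_slices_le[OF G slice2] mult_left_mono[OF hS]]) auto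
    show "(\<integral>\<^sup>+ y. ?I y \<partial>M) \<le> ennreal v * ennreal T"
      unfolding A_def
      by (rule order_trans[OF nn_integral_slices_le[OF G slice2] mult_left_mono[OF gT]]) auto
  qed simp_all
  also have "\<dots> = ennreal (2 powr m * (v * (S powr (m - 1) * S) + 2 powr m * v powr (m - 1) * (v * T)))"
    using \<open>0 \<le> S\<close> \<open>0 \<le> T\<close> \<open>0 < v\<close>
    by (simp add: mult_ac flip: ennreal_mult ennreal_plus)
  also have "v * (S powr (m - 1) * S) = K powr m * (w powr p * v powr (1 + m - p / \<alpha>))"
  proof -
    have "S powr (m - 1) * S = S powr m"
      using \<open>0 \<le> S\<close> \<open>1 < m\<close> by (cases "S = 0") (auto simp: powr_diff)
    also have "\<dots> = K powr m * (w powr p * v powr (m - p / \<alpha>))"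
      using \<open>0 \<le> K\<close> \<open>0 < w\<close> \<open>0 < v\<close> qm
      by (simp add: S_def powr_mult powr_powr left_diff_distrib)
    finally show ?thesis
      using \<open>0 < v\<close> by (simp add: powr_add powr_diff mult_ac)
  qed
  also have "2 powr m * v powr (m - 1) * (v * T)
      = 2 powr m * L * (w powr p * v powr (1 + m - p / \<alpha>))"
    using \<open>0 < v\<close> by (simp add: T_def powr_add powr_diff)
  finally show ?thesis
    unfolding A_def K_def L_def m_def by (simp add: algebra_simps)
qed

section \<open>Balls in spaces of homogeneous type\<close>

context homogeneous_type_space
begin

lemma dist_nonneg: "x \<in> space M \<Longrightarrow> y \<in> space M \<Longrightarrow> 0 \<le> d x y"
  using quasi_metric[unfolded quasi_metric_def, THEN conjunct1] by simp

lemma dist_self: "x \<in> space M \<Longrightarrow> d x x = 0"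
  using quasi_metric[unfolded quasi_metric_def, THEN conjunct2, THEN conjunct1] by simp

lemma dist_sym: "x \<in> space M \<Longrightarrow> y \<in> space M \<Longrightarrow> d x y = d y x"
  using quasi_metric[unfolded quasi_metric_def, THEN conjunct2, THEN conjunct2, THEN conjunct1]
  by (auto dest: bspec)

lemma quasi_triangle:
  obtains \<kappa> where "1 \<le> \<kappa>"
    and "\<And>x y z. x \<in> space M \<Longrightarrow> y \<in> space M \<Longrightarrow> z \<in> space M \<Longrightarrow> d x y \<le> \<kappa> * (d x z + d z y)"
  using quasi_metric[unfolded quasi_metric_def, THEN conjunct2, THEN conjunct2, THEN conjunct2]
  by blast

lemma sets_qball [measurable]:
  assumes "x \<in> space M"
  shows "qball (space M) d x r \<in> sets M"
proof (cases "0 < r")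
  case True
  then show ?thesis
    unfolding borel using openin_qball[OF assms] by (intro sigma_sets.Basic) simp
next
  case False
  moreover have "0 \<le> d x y" if "y \<in> space M" for y
    using dist_nonneg[OF assms that] .
  ultimately have "qball (space M) d x r = {}"
    by (fastforce simp: qball_def)
  then show ?thesis by simp
qed

lemma emeasure_qball_pos: "x \<in> space M \<Longrightarrow> 0 < r \<Longrightarrow> 0 < emeasure M (qball (space M) d x r)"
  using doubling by (metis half_gt_zero field_sum_of_halves mult_2)

lemma emeasure_qball_finite:
  assumes "x \<in> space M" "0 < r"
  shows "emeasure M (qball (space M) d x r) < \<infinity>"
proof -
  obtain C :: real where
    "emeasure M (qball (space M) d x (2 * (r / 2))) \<le> ennreal C * emeasure M (qball (space M) d x (r / 2))"
    "ennreal C * emeasure M (qball (space M) d x (r / 2)) < \<infinity>"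
    using doubling assms half_gt_zero by meson
  then show ?thesis by simp
qed

lemma measure_qball_pos: "x \<in> space M \<Longrightarrow> 0 < r \<Longrightarrow> 0 < measure M (qball (space M) d x r)"
  using emeasure_qball_pos[of x r] emeasure_qball_finite[of x r]
  by (simp add: measure_def enn2real_positive_iff)

lemma doubling_measure:
  obtains D where "1 \<le> D"
    and "\<And>x r. x \<in> space M \<Longrightarrow> 0 < r \<Longrightarrow>
          measure M (qball (space M) d x (2 * r)) \<le> D * measure M (qball (space M) d x r)"
proof -
  obtain C :: real where C: "\<And>x r. x \<in> space M \<Longrightarrow> 0 < r \<Longrightarrow>
          emeasure M (qball (space M) d x (2 * r)) \<le> ennreal C * emeasure M (qball (space M) d x r)"
    using doubling by blast
  show thesis
  proof
    show "1 \<le> max C 1" by simp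
    fix x and r :: real assume xr: "x \<in> space M" "0 < r"
    have "ennreal (measure M (qball (space M) d x (2 * r))) = emeasure M (qball (space M) d x (2 * r))"
      using emeasure_qball_finite[of x "2 * r"] xr
      by (intro emeasure_eq_ennreal_measure[symmetric]) auto
    also have "\<dots> \<le> ennreal C * emeasure M (qball (space M) d x r)" by (rule C[OF xr])
    also have "\<dots> \<le> ennreal (max C 1) * emeasure M (qball (space M) d x r)"
      by (intro mult_right_mono ennreal_leI) auto
    also have "\<dots> = ennreal (max C 1 * measure M (qball (space M) d x r))"
      using emeasure_qball_finite[OF xr] by (subst ennreal_mult) (auto simp: emeasure_eq_ennreal_measure)
    finally show "measure M (qball (space M) d x (2 * r)) \<le> max C 1 * measure M (qball (space M) d x r)"
      by (subst (asm) ennreal_le_iff) auto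
  qed
qed

lemma doubling_measure_dilation:
  obtains D where "0 < D"
    and "\<And>x r. x \<in> space M \<Longrightarrow> 0 < r \<Longrightarrow>
          measure M (qball (space M) d x (R * r)) \<le> D * measure M (qball (space M) d x r)"
proof -
  obtain D where "1 \<le> D"
    and D: "\<And>x r. x \<in> space M \<Longrightarrow> 0 < r \<Longrightarrow>
          measure M (qball (space M) d x (2 * r)) \<le> D * measure M (qball (space M) d x r)"
    using doubling_measure by blast
  have iter: "measure M (qball (space M) d x (2 ^ n * r)) \<le> D ^ n * measure M (qball (space M) d x r)"
    if "x \<in> space M" "0 < r" for x r n
  proof (induction n)
    case (Suc n)
    have "measure M (qball (space M) d x (2 ^ Suc n * r))
        \<le> D * measure M (qball (space M) d x (2 ^ n * r))"
      using D[of x "2 ^ n * r"] that by (simp add: mult.assoc)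
    also have "\<dots> \<le> D * (D ^ n * measure M (qball (space M) d x r))"
      using Suc \<open>1 \<le> D\<close> by (intro mult_left_mono) auto
    finally show ?case by (simp add: mult.assoc)
  qed simp
  obtain n where n: "R < 2 ^ n" using real_arch_pow[of 2 R] by auto
  show thesis
  proof
    show "0 < D ^ n" using \<open>1 \<le> D\<close> by simp
    fix x and r :: real assume xr: "x \<in> space M" "0 < r"
    then have "R * r < 2 ^ n * r" using n by simp
    then have "qball (space M) d x (R * r) \<subseteq> qball (space M) d x (2 ^ n * r)"
      by (auto simp: qball_def)
    then have "measure M (qball (space M) d x (R * r)) \<le> measure M (qball (space M) d x (2 ^ n * r))"
      using xr emeasure_qball_finite[of x "2 ^ n * r"]
      by (intro measure_mono_fmeasurable) (auto simp: fmeasurable_def sets_qball)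
    also have "\<dots> \<le> D ^ n * measure M (qball (space M) d x r)" by (rule iter[OF xr])
    finally show "measure M (qball (space M) d x (R * r)) \<le> D ^ n * measure M (qball (space M) d x r)" .
  qed
qed

text \<open>
  The balls of integer radius around one point exhaust the space.
\<close>
lemma sigma_finite_completion: "sigma_finite_measure (completion M)"
proof
  have "space M \<noteq> {}" using infinite_measure by auto
  then obtain x where x: "x \<in> space M" by blast
  have fin: "emeasure M (qball (space M) d x (real (Suc n))) < \<infinity>" for n
    by (rule emeasure_qball_finite[OF x]) simp
  show "\<exists>A. countable A \<and> A \<subseteq> sets (completion M) \<and> \<Union>A = space (completion M) \<and>
      (\<forall>a\<in>A. emeasure (completion M) a \<noteq> \<infinity>)"
  proof (intro exI conjI ballI)
    let ?A = "range (\<lambda>n. qball (space M) d x (real (Suc n)))"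
    show "countable ?A" by simp
    show "?A \<subseteq> sets (completion M)" using x sets_qball by auto
    have "\<exists>n. d x y < real (Suc n)" for y
    proof -
      obtain n where "d x y < real n" using reals_Archimedean2 by blast
      then have "d x y < real (Suc n)" by simp
      then show ?thesis ..
    qed
    then show "\<Union>?A = space (completion M)" by (auto simp: qball_def)
    fix a assume "a \<in> ?A"
    then obtain n where "a = qball (space M) d x (real (Suc n))" by blast
    then show "emeasure (completion M) a \<noteq> \<infinity>" using fin[of n] sets_qball[OF x] by simp
  qed
qed

text \<open>
  The relation \<open>G\<close> is the union of \<open>B(c,r) \<times> B(c,2\<kappa>r)\<close> over \<open>c\<close> in a countable dense set. If
  \<open>d x y < r\<close>, then the open ball \<open>B(x,r)\<close> contains some such \<open>c\<close>, and the quasi-triangle inequality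
  gives \<open>d c y < 2\<kappa>r\<close>, so \<open>(x, y)\<close> is in \<open>G\<close>. Conversely, two points related by \<open>G\<close> are both close to
  some \<open>c\<close>, and hence at distance less than \<open>\<kappa>(1 + 2\<kappa>)r\<close>.
\<close>
lemma measurable_ball_relation:
  obtains R where "0 < R"
    and "\<And>r. 0 < r \<Longrightarrow> \<exists>G \<in> sets (completion M \<Otimes>\<^sub>M completion M).
        (\<forall>x\<in>space M. qball (space M) d x r \<subseteq> {y \<in> space M. (x, y) \<in> G}) \<and>
        (\<forall>x\<in>space M. {y \<in> space M. (x, y) \<in> G} \<subseteq> qball (space M) d x (R * r)) \<and>
        (\<forall>x\<in>space M. {y \<in> space M. (y, x) \<in> G} \<subseteq> qball (space M) d x (R * r))"
proof -
  obtain \<kappa> where "1 \<le> \<kappa>" and \<kappa>: "\<And>x y z. x \<in> space M \<Longrightarrow> y \<in> space M \<Longrightarrow> z \<in> space M \<Longrightarrow>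
      d x y \<le> \<kappa> * (d x z + d z y)"
    using quasi_triangle by blast
  note sym = dist_sym and d0 = dist_self
  obtain C where C: "countable C" "C \<subseteq> space M"
      and closure: "qtopology (space M) d closure_of C = topspace (qtopology (space M) d)"
    using separable unfolding separable_space_def by (auto simp: topspace_qtopology)
  have dense: "C \<inter> U \<noteq> {}" if "openin (qtopology (space M) d) U" "U \<noteq> {}" for U
    using closure that unfolding dense_intersects_open by blast
  show thesis
  proof
    let ?R = "\<kappa> * (1 + 2 * \<kappa>)"
    show "0 < ?R" using \<open>1 \<le> \<kappa>\<close> by simp
    fix r :: real assume "0 < r"
    define G where "G = (\<Union>c\<in>C. qball (space M) d c r \<times> qball (space M) d c (2 * \<kappa> * r))"
    have near: "d x y < ?R * r"
      if "c \<in> C" "x \<in> qball (space M) d c r" "y \<in> qball (space M) d c (2 * \<kappa> * r)" for c x y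
    proof -
      have "c \<in> space M" "x \<in> space M" "y \<in> space M" "d c x < r" "d c y < 2 * \<kappa> * r"
        using that C by (auto simp: qball_def)
      then have "d x y \<le> \<kappa> * (d c x + d c y)" using \<kappa>[of x y c] sym[of x c] by simp
      also have "\<dots> < \<kappa> * (r + 2 * \<kappa> * r)"
        using \<open>1 \<le> \<kappa>\<close> \<open>d c x < r\<close> \<open>d c y < 2 * \<kappa> * r\<close> by (intro mult_strict_left_mono) auto
      finally show ?thesis by (simp add: algebra_simps)
    qed
    show "\<exists>G \<in> sets (completion M \<Otimes>\<^sub>M completion M).
        (\<forall>x\<in>space M. qball (space M) d x r \<subseteq> {y \<in> space M. (x, y) \<in> G}) \<and>
        (\<forall>x\<in>space M. {y \<in> space M. (x, y) \<in> G} \<subseteq> qball (space M) d x (?R * r)) \<and>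
        (\<forall>x\<in>space M. {y \<in> space M. (y, x) \<in> G} \<subseteq> qball (space M) d x (?R * r))"
    proof (intro bexI[of _ G] conjI ballI subsetI)
      show "G \<in> sets (completion M \<Otimes>\<^sub>M completion M)"
        unfolding G_def using C sets_qball by (intro sets.countable_UN'' pair_measureI) auto
    next
      fix x y assume x: "x \<in> space M" and "y \<in> qball (space M) d x r"
      then have y: "y \<in> space M" "d x y < r" by (auto simp: qball_def)
      have "x \<in> qball (space M) d x r" using x d0 \<open>0 < r\<close> by (auto simp: qball_def)
      then obtain c where c: "c \<in> C" "d x c < r"
        using dense[OF openin_qball[OF x \<open>0 < r\<close>]] by (auto simp: qball_def)
      then have cM: "c \<in> space M" using C by blast
      have "d c y \<le> \<kappa> * (d x c + d x y)" using \<kappa>[of c y x] x y cM sym[of c x] by simp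
      also have "\<dots> < \<kappa> * (r + r)"
        using \<open>1 \<le> \<kappa>\<close> c y by (intro mult_strict_left_mono) auto
      finally have "d c y < 2 * \<kappa> * r" by simp
      then show "y \<in> {y \<in> space M. (x, y) \<in> G}"
        using c x y cM sym[of c x] by (auto simp: G_def qball_def intro!: bexI[of _ c])
    next
      fix x y assume "x \<in> space M" "y \<in> {y \<in> space M. (x, y) \<in> G}"
      then show "y \<in> qball (space M) d x (?R * r)"
        using near by (auto simp: G_def qball_def)
    next
      fix x y assume "x \<in> space M" "y \<in> {y \<in> space M. (y, x) \<in> G}"
      then show "y \<in> qball (space M) d x (?R * r)"
        using near[of _ y x] sym[of x y] by (auto simp: G_def)
           (auto simp: qball_def)
    qed
  qed
qed

end

section \<open>Amalgam norms at a fixed radius\<close>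

text \<open>
  Enlarging the ball to a section of a measurable relation only increases the local norm.

\<close>
lemma Lq_norm_restrict_le:
  assumes "0 < q" "A \<subseteq> S"
  shows "Lq_norm M q (\<lambda>x. f x * indicator A x)
    \<le> epowr (\<integral>\<^sup>+ x. ennreal (norm (f x) powr q) * indicator S x \<partial>completion M) (1 / q)"
  unfolding Lq_norm_def using assms
  by (intro epowr_mono nn_integral_mono) (auto simp: indicator_def norm_mult)

text \<open>
  The weight has a negative exponent, so a lower bound for the measures of the balls bounds it from
  above and lets it be pulled out of the outer integral.
\<close>
lemma amalgam_norm_at_finite_le:
  fixes q p' \<alpha> :: real
  assumes "0 < q" "0 < p'" "0 < l" and exponent: "1 / \<alpha> - 1 / p' - 1 / q \<le> 0"
    and lower: "\<And>y. y \<in> space M \<Longrightarrow> l \<le> measure M (qball (space M) d y r)"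
    and sub: "\<And>y. y \<in> space M \<Longrightarrow> qball (space M) d y r \<subseteq> S y"
    and meas [measurable]: "(\<lambda>y. \<integral>\<^sup>+ x. ennreal (norm (f x) powr q) * indicator (S y) x \<partial>completion M)
        \<in> borel_measurable (completion M)"
    and bound: "(\<integral>\<^sup>+ y. epowr (\<integral>\<^sup>+ x. ennreal (norm (f x) powr q) * indicator (S y) x \<partial>completion M) (p' / q)
        \<partial>completion M) \<le> ennreal B" and "0 \<le> B"
  shows "amalgam_norm_at M d q (ennreal p') \<alpha> r f
      \<le> ennreal ((l powr (p' * (1 / \<alpha> - 1 / p' - 1 / q)) * B) powr (1 / p'))"
proof -
  define e where "e = 1 / \<alpha> - 1 / p' - 1 / q"
  define V where "V = (\<lambda>y. \<integral>\<^sup>+ x. ennreal (norm (f x) powr q) * indicator (S y) x \<partial>completion M)"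
  have "(\<integral>\<^sup>+ y. epowr (ennreal (measure M (qball (space M) d y r) powr e) *
          Lq_norm M q (\<lambda>x. f x * indicator (qball (space M) d y r) x)) p' \<partial>completion M)
      \<le> (\<integral>\<^sup>+ y. ennreal (l powr (p' * e)) * epowr (V y) (p' / q) \<partial>completion M)"
  proof (rule nn_integral_mono)
    fix y assume "y \<in> space (completion M)"
    then have y: "y \<in> space M" by simp
    have "epowr (ennreal (measure M (qball (space M) d y r) powr e) *
          Lq_norm M q (\<lambda>x. f x * indicator (qball (space M) d y r) x)) p'
        \<le> epowr (ennreal (l powr e) * epowr (V y) (1 / q)) p'"
      unfolding V_def using assms y
      by (intro epowr_mono mult_mono ennreal_leI powr_mono2' Lq_norm_restrict_le) (auto simp: e_def)
    also have "\<dots> = ennreal (l powr (p' * e)) * epowr (V y) (p' / q)"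
      using \<open>0 < l\<close> by (subst epowr_cmult) (auto simp: epowr_epowr powr_powr mult.commute)
    finally show "epowr (ennreal (measure M (qball (space M) d y r) powr e) *
          Lq_norm M q (\<lambda>x. f x * indicator (qball (space M) d y r) x)) p'
        \<le> ennreal (l powr (p' * e)) * epowr (V y) (p' / q)" .
  qed
  also have "\<dots> \<le> ennreal (l powr (p' * e) * B)"
  proof -
    have "(\<integral>\<^sup>+ y. ennreal (l powr (p' * e)) * epowr (V y) (p' / q) \<partial>completion M)
      = ennreal (l powr (p' * e)) * (\<integral>\<^sup>+ y. epowr (V y) (p' / q) \<partial>completion M)"
      using meas unfolding V_def by (intro nn_integral_cmult) measurable
    also have "\<dots> \<le> ennreal (l powr (p' * e)) * ennreal B"
      using bound by (intro mult_left_mono) (auto simp: V_def)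
    finally show ?thesis using \<open>0 \<le> B\<close> by (simp add: ennreal_mult)
  qed
  finally have "epowr (\<integral>\<^sup>+ y. epowr (ennreal (measure M (qball (space M) d y r) powr e) *
          Lq_norm M q (\<lambda>x. f x * indicator (qball (space M) d y r) x)) p' \<partial>completion M) (1 / p')
     \<le> epowr (ennreal (l powr (p' * e) * B)) (1 / p')"
    using \<open>0 < p'\<close> by (intro epowr_mono) auto
  then show ?thesis
    using \<open>0 < p'\<close> \<open>0 \<le> B\<close>
    by (simp add: amalgam_norm_at_def Let_def e_def epowr_ennreal)
qed

lemma amalgam_norm_at_infinite_le:
  fixes q \<alpha> :: real
  assumes "0 < q" "0 < l" and exponent: "1 / \<alpha> - 1 / q \<le> 0"
    and lower: "\<And>y. y \<in> space M \<Longrightarrow> l \<le> measure M (qball (space M) d y r)"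
    and sub: "\<And>y. y \<in> space M \<Longrightarrow> qball (space M) d y r \<subseteq> S y"
    and bound: "\<And>y. y \<in> space M \<Longrightarrow>
        (\<integral>\<^sup>+ x. ennreal (norm (f x) powr q) * indicator (S y) x \<partial>completion M) \<le> ennreal B"
    and "0 \<le> B"
  shows "amalgam_norm_at M d q \<infinity> \<alpha> r f \<le> ennreal (l powr (1 / \<alpha> - 1 / q) * B powr (1 / q))"
proof -
  have "ennreal (measure M (qball (space M) d y r) powr (1 / \<alpha> - 1 / q)) *
          Lq_norm M q (\<lambda>x. f x * indicator (qball (space M) d y r) x)
      \<le> ennreal (l powr (1 / \<alpha> - 1 / q)) * epowr (ennreal B) (1 / q)" if y: "y \<in> space M" for y
  proof (intro mult_mono ennreal_leI powr_mono2' exponent lower y \<open>0 < l\<close>)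
    have "Lq_norm M q (\<lambda>x. f x * indicator (qball (space M) d y r) x)
        \<le> epowr (\<integral>\<^sup>+ x. ennreal (norm (f x) powr q) * indicator (S y) x \<partial>completion M) (1 / q)"
      by (rule Lq_norm_restrict_le[OF \<open>0 < q\<close> sub[OF y]])
    also have "\<dots> \<le> epowr (ennreal B) (1 / q)"
      using \<open>0 < q\<close> bound[OF y] by (intro epowr_mono) auto
    finally show "Lq_norm M q (\<lambda>x. f x * indicator (qball (space M) d y r) x)
        \<le> epowr (ennreal B) (1 / q)" .
  qed auto
  then show ?thesis
    using \<open>0 \<le> B\<close> by (auto simp: amalgam_norm_at_def epowr_ennreal ennreal_mult intro!: SUP_least)
qed

text \<open>
  The lower bound \<open>a t\<close> and the upper bound \<open>D t\<close> for the measures of balls enter with opposite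
  exponents, so \<open>t\<close> cancels. The resulting constant is therefore the same at every radius.
\<close>
lemma powr_rescale:
  fixes a D w t K :: real
  assumes "0 < a" "0 < D" "0 < w" "0 < t" "0 \<le> K" "0 < p"
  shows "((a * t) powr e * (K * (w powr p * (D * t) powr (- e)))) powr (1 / p)
      = (K * (D / a) powr (- e)) powr (1 / p) * w"
proof -
  have "(a * t) powr e * (K * (w powr p * (D * t) powr (- e))) = K * (D / a) powr (- e) * w powr p"
    using assms by (simp add: powr_mult powr_divide powr_minus_divide)
  then show ?thesis
    using assms by (simp only: powr_mult[of "K * (D / a) powr (- e)"] powr_powr) simp
qed

text \<open>
  In the application \<open>t = \<phi> r\<close>. The constant is chosen before \<open>f\<close>, \<open>w\<close>, \<open>r\<close>, \<open>t\<close> and \<open>G\<close>. This uniformity is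
  what permits the supremum over \<open>r\<close> in the end.
\<close>
lemma amalgam_norm_at_le_of_ball_relation:
  fixes q \<alpha> a D :: real and p :: ennreal
  assumes "sigma_finite_measure (completion M)"
    and "0 < q" "q < \<alpha>" "ennreal \<alpha> < p" "0 < a" "0 < D"
  obtains C where "0 < C"
    and "\<And>f w r t G. f \<in> L0 M \<Longrightarrow> 0 < w \<Longrightarrow> weak_norm M \<alpha> f \<le> ennreal w \<Longrightarrow> 0 < t \<Longrightarrow>
      (\<And>y. y \<in> space M \<Longrightarrow> a * t \<le> measure M (qball (space M) d y r)) \<Longrightarrow>
      G \<in> sets (completion M \<Otimes>\<^sub>M completion M) \<Longrightarrow>
      (\<And>y. y \<in> space M \<Longrightarrow> qball (space M) d y r \<subseteq> {x \<in> space M. (y, x) \<in> G}) \<Longrightarrow>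
      (\<And>y. y \<in> space M \<Longrightarrow> emeasure (completion M) {x \<in> space M. (y, x) \<in> G} \<le> ennreal (D * t)) \<Longrightarrow>
      (\<And>x. x \<in> space M \<Longrightarrow> emeasure (completion M) {y \<in> space M. (y, x) \<in> G} \<le> ennreal (D * t)) \<Longrightarrow>
      amalgam_norm_at M d q p \<alpha> r f \<le> ennreal (C * w)"
proof -
  interpret N: sigma_finite_measure "completion M" by fact
  have "0 < \<alpha>" using assms by simp
  have weak: "emeasure (completion M) {x \<in> space (completion M). s < norm (f x)}
      \<le> ennreal ((w / s) powr \<alpha>)"
    if "f \<in> L0 M" "0 < w" "weak_norm M \<alpha> f \<le> ennreal w" "0 < s" for f w s
    using distribution_fun_le_if_weak_norm_le[OF that(3,1) \<open>0 < \<alpha>\<close> that(2,4)]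
    by (simp add: distribution_fun_def)
  show thesis
  proof (cases p)
    case (real p')
    then have "\<alpha> < p'" using assms(4) \<open>0 < \<alpha>\<close> by (simp add: ennreal_less_iff)
    then have "0 < p'" using \<open>0 < \<alpha>\<close> by simp
    define K where "K = 2 powr (p' / q) * ((2 powr q / (1 - 2 powr (q - \<alpha>))) powr (p' / q)
            + 2 powr (p' / q) * (2 powr \<alpha> / (1 - 2 powr (\<alpha> - p'))))"
    define e where "e = p' * (1 / \<alpha> - 1 / p' - 1 / q)"
    have e: "1 + p' / q - p' / \<alpha> = - e" using \<open>0 < p'\<close> by (simp add: e_def right_diff_distrib)
    have "0 < K"
      unfolding K_def using \<open>q < \<alpha>\<close> \<open>\<alpha> < p'\<close>
      by (intro mult_pos_pos add_nonneg_pos) (auto simp: powr_less_one)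
    show thesis
    proof (rule that)
      show "0 < (K * (D / a) powr (- e)) powr (1 / p')"
        using \<open>0 < K\<close> \<open>0 < D\<close> \<open>0 < a\<close> by simp
      fix f w r t G
      assume f: "f \<in> L0 M" "0 < w" "weak_norm M \<alpha> f \<le> ennreal w" and "(0::real) < t"
        and lower: "\<And>y. y \<in> space M \<Longrightarrow> a * t \<le> measure M (qball (space M) d y r)"
        and G [measurable]: "G \<in> sets (completion M \<Otimes>\<^sub>M completion M)"
        and sub: "\<And>y. y \<in> space M \<Longrightarrow> qball (space M) d y r \<subseteq> {x \<in> space M. (y, x) \<in> G}"
        and slice: "\<And>y. y \<in> space M \<Longrightarrow> emeasure (completion M) {x \<in> space M. (y, x) \<in> G} \<le> ennreal (D * t)"
          "\<And>x. x \<in> space M \<Longrightarrow> emeasure (completion M) {y \<in> space M. (y, x) \<in> G} \<le> ennreal (D * t)"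
      have [measurable]: "f \<in> borel_measurable (completion M)" using f by (simp add: L0_def)
      have "amalgam_norm_at M d q (ennreal p') \<alpha> r f
         \<le> ennreal (((a * t) powr e * (K * (w powr p' * (D * t) powr (- e)))) powr (1 / p'))"
        unfolding e_def
      proof (rule amalgam_norm_at_finite_le[where S = "\<lambda>y. {x \<in> space M. (y, x) \<in> G}"])
        have "1 / \<alpha> \<le> 1 / q" "0 \<le> 1 / p'"
          using assms(2,3) \<open>0 < p'\<close> by (auto simp: field_simps)
        then show "1 / \<alpha> - 1 / p' - 1 / q \<le> 0" by linarith
        have "(\<lambda>y. \<integral>\<^sup>+ x. ennreal (norm (f x) powr q) * indicator G (y, x) \<partial>completion M)
            \<in> borel_measurable (completion M)"
          by measurable
        then show "(\<lambda>y. \<integral>\<^sup>+ x. ennreal (norm (f x) powr q) *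
            indicator {x \<in> space M. (y, x) \<in> G} x \<partial>completion M) \<in> borel_measurable (completion M)"
          by (rule measurable_cong[THEN iffD1, rotated])
             (auto intro!: nn_integral_cong simp: indicator_def)
        have "(\<integral>\<^sup>+ y. epowr (\<integral>\<^sup>+ x. ennreal (norm (f x) powr q) *
            indicator {x \<in> space (completion M). (y, x) \<in> G} x \<partial>completion M) (p' / q) \<partial>completion M)
          \<le> ennreal (K * (w powr p' * (D * t) powr (1 + p' / q - p' / \<alpha>)))"
          unfolding K_def using \<open>0 < D\<close> \<open>0 < t\<close> slice
          by (intro N.weak_type_slices_estimate weak f G \<open>0 < q\<close> \<open>q < \<alpha>\<close> \<open>\<alpha> < p'\<close>) auto
        then show "(\<integral>\<^sup>+ y. epowr (\<integral>\<^sup>+ x. ennreal (norm (f x) powr q) *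
            indicator {x \<in> space M. (y, x) \<in> G} x \<partial>completion M) (p' / q) \<partial>completion M)
          \<le> ennreal (K * (w powr p' * (D * t) powr (- (p' * (1 / \<alpha> - 1 / p' - 1 / q)))))"
          by (simp add: e[unfolded e_def])
        show "0 < a * t" using \<open>0 < a\<close> \<open>0 < t\<close> by simp
        show "0 \<le> K * (w powr p' * (D * t) powr - (p' * (1 / \<alpha> - 1 / p' - 1 / q)))"
          using \<open>0 < K\<close> by simp
      qed fact+
      also have "\<dots> = ennreal ((K * (D / a) powr (- e)) powr (1 / p') * w)"
        using \<open>0 < a\<close> \<open>0 < D\<close> \<open>0 < w\<close> \<open>0 < t\<close> \<open>0 < K\<close> \<open>0 < p'\<close>
        by (subst powr_rescale) auto
      finally show "amalgam_norm_at M d q p \<alpha> r f \<le> ennreal ((K * (D / a) powr (- e)) powr (1 / p') * w)"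
        by (simp add: real)
    qed
  next
    case top
    define K where "K = 1 + 2 powr q / (1 - 2 powr (q - \<alpha>))"
    define e where "e = q * (1 / \<alpha> - 1 / q)"
    have e: "1 - q / \<alpha> = - e" using \<open>0 < q\<close> by (simp add: e_def right_diff_distrib)
    have "0 < K"
      unfolding K_def using \<open>q < \<alpha>\<close> by (intro add_pos_nonneg) (auto simp: powr_less_one less_imp_le)
    show thesis
    proof (rule that)
      show "0 < (K * (D / a) powr (- e)) powr (1 / q)"
        using \<open>0 < K\<close> \<open>0 < D\<close> \<open>0 < a\<close> by simp
      fix f w r t G
      assume f: "f \<in> L0 M" "0 < w" "weak_norm M \<alpha> f \<le> ennreal w" and "(0::real) < t"
        and lower: "\<And>y. y \<in> space M \<Longrightarrow> a * t \<le> measure M (qball (space M) d y r)"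
        and G [measurable]: "G \<in> sets (completion M \<Otimes>\<^sub>M completion M)"
        and sub: "\<And>y. y \<in> space M \<Longrightarrow> qball (space M) d y r \<subseteq> {x \<in> space M. (y, x) \<in> G}"
        and slice: "\<And>y. y \<in> space M \<Longrightarrow> emeasure (completion M) {x \<in> space M. (y, x) \<in> G} \<le> ennreal (D * t)"
      have [measurable]: "f \<in> borel_measurable (completion M)" using f by (simp add: L0_def)
      let ?B = "K * (w powr q * (D * t) powr (- e))"
      have "amalgam_norm_at M d q \<infinity> \<alpha> r f \<le> ennreal ((a * t) powr (1 / \<alpha> - 1 / q) * ?B powr (1 / q))"
      proof (rule amalgam_norm_at_infinite_le[where S = "\<lambda>y. {x \<in> space M. (y, x) \<in> G}"])
        show "1 / \<alpha> - 1 / q \<le> 0" using assms(2,3) by (simp add: field_simps)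
        show "(\<integral>\<^sup>+ x. ennreal (norm (f x) powr q) *
            indicator {x \<in> space M. (y, x) \<in> G} x \<partial>completion M) \<le> ennreal ?B"
          if y: "y \<in> space M" for y
        proof -
          have y': "y \<in> space (completion M)" using y by simp
          have "{x \<in> space (completion M). (y, x) \<in> G} \<in> sets (completion M)"
            using y' by measurable
          then show ?thesis
            unfolding e[symmetric] K_def using \<open>0 < D\<close> \<open>0 < t\<close> slice[OF y]
            by (intro kolmogorov_inequality weak f \<open>0 < q\<close> \<open>q < \<alpha>\<close>) auto
        qed
        show "0 < a * t" using \<open>0 < a\<close> \<open>0 < t\<close> by simp
        show "0 \<le> ?B" using \<open>0 < K\<close> by simp
      qed fact+
      also have "(a * t) powr (1 / \<alpha> - 1 / q) * ?B powr (1 / q) = ((a * t) powr e * ?B) powr (1 / q)"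
        using \<open>0 < q\<close> \<open>0 < a\<close> \<open>0 < t\<close> \<open>0 < K\<close> by (simp add: e_def powr_mult powr_powr)
      also have "\<dots> = (K * (D / a) powr (- e)) powr (1 / q) * w"
        using \<open>0 < a\<close> \<open>0 < D\<close> \<open>0 < w\<close> \<open>0 < t\<close> \<open>0 < K\<close> \<open>0 < q\<close>
        by (subst powr_rescale) auto
      finally show "amalgam_norm_at M d q p \<alpha> r f \<le> ennreal ((K * (D / a) powr (- e)) powr (1 / q) * w)"
        by (simp add: top)
    qed
  qed
qed

lemma (in homogeneous_type_space) amalgam_norm_at_le_weak:
  fixes q \<alpha> a b :: real and p :: ennreal and \<phi> :: "real \<Rightarrow> real"
  assumes "0 < q" "q < \<alpha>" "ennreal \<alpha> < p" "0 < a" "0 < b"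
    and \<phi>: "\<And>x r. x \<in> space M \<Longrightarrow> 0 < r \<Longrightarrow>
           a * \<phi> r \<le> measure M (qball (space M) d x r) \<and>
           measure M (qball (space M) d x r) \<le> b * \<phi> r"
  obtains C where "0 < C"
    and "\<And>f w r. f \<in> L0 M \<Longrightarrow> 0 < w \<Longrightarrow> weak_norm M \<alpha> f \<le> ennreal w \<Longrightarrow> 0 < r \<Longrightarrow>
           amalgam_norm_at M d q p \<alpha> r f \<le> ennreal (C * w)"
proof -
  obtain R where "0 < R" and ball_relation: "\<And>r. 0 < r \<Longrightarrow> \<exists>G \<in> sets (completion M \<Otimes>\<^sub>M completion M).
        (\<forall>x\<in>space M. qball (space M) d x r \<subseteq> {y \<in> space M. (x, y) \<in> G}) \<and>
        (\<forall>x\<in>space M. {y \<in> space M. (x, y) \<in> G} \<subseteq> qball (space M) d x (R * r)) \<and>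
        (\<forall>x\<in>space M. {y \<in> space M. (y, x) \<in> G} \<subseteq> qball (space M) d x (R * r))"
    using measurable_ball_relation by blast
  obtain E where "0 < E" and E: "\<And>x r. x \<in> space M \<Longrightarrow> 0 < r \<Longrightarrow>
          measure M (qball (space M) d x (R * r)) \<le> E * measure M (qball (space M) d x r)"
    using doubling_measure_dilation by blast
  obtain x0 where x0: "x0 \<in> space M" using infinite_measure by fastforce
  have \<phi>_pos: "0 < \<phi> r" if "0 < r" for r
  proof -
    have "0 < measure M (qball (space M) d x0 r)" by (rule measure_qball_pos[OF x0 that])
    also have "\<dots> \<le> b * \<phi> r" using \<phi>[OF x0 that] by simp
    finally show ?thesis using \<open>0 < b\<close> by (simp add: zero_less_mult_iff)
  qed
  have "0 < E * b" using \<open>0 < E\<close> \<open>0 < b\<close> by simp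
  show thesis
  proof (rule amalgam_norm_at_le_of_ball_relation
      [OF sigma_finite_completion \<open>0 < q\<close> \<open>q < \<alpha>\<close> \<open>ennreal \<alpha> < p\<close> \<open>0 < a\<close> \<open>0 < E * b\<close>],
      rule that)
    fix C :: real assume "0 < C" then show "0 < C" .
  next
    fix C f w r
    assume C: "\<And>f w r t G. f \<in> L0 M \<Longrightarrow> 0 < w \<Longrightarrow> weak_norm M \<alpha> f \<le> ennreal w \<Longrightarrow> 0 < t \<Longrightarrow>
      (\<And>y. y \<in> space M \<Longrightarrow> a * t \<le> measure M (qball (space M) d y r)) \<Longrightarrow>
      G \<in> sets (completion M \<Otimes>\<^sub>M completion M) \<Longrightarrow>
      (\<And>y. y \<in> space M \<Longrightarrow> qball (space M) d y r \<subseteq> {x \<in> space M. (y, x) \<in> G}) \<Longrightarrow>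
      (\<And>y. y \<in> space M \<Longrightarrow> emeasure (completion M) {x \<in> space M. (y, x) \<in> G} \<le> ennreal (E * b * t)) \<Longrightarrow>
      (\<And>x. x \<in> space M \<Longrightarrow> emeasure (completion M) {y \<in> space M. (y, x) \<in> G} \<le> ennreal (E * b * t)) \<Longrightarrow>
      amalgam_norm_at M d q p \<alpha> r f \<le> ennreal (C * w)"
      and f: "f \<in> L0 M" "0 < w" "weak_norm M \<alpha> f \<le> ennreal w" and r: "(0::real) < r"
    obtain G where G: "G \<in> sets (completion M \<Otimes>\<^sub>M completion M)"
      and sub: "\<And>x. x \<in> space M \<Longrightarrow> qball (space M) d x r \<subseteq> {y \<in> space M. (x, y) \<in> G}"
      and sup: "\<And>x. x \<in> space M \<Longrightarrow> {y \<in> space M. (x, y) \<in> G} \<subseteq> qball (space M) d x (R * r)"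
        "\<And>x. x \<in> space M \<Longrightarrow> {y \<in> space M. (y, x) \<in> G} \<subseteq> qball (space M) d x (R * r)"
      using ball_relation[OF r] by meson
    have slice: "emeasure (completion M) A \<le> ennreal (E * b * \<phi> r)"
      if x: "x \<in> space M" and A: "A \<subseteq> qball (space M) d x (R * r)" for x A
    proof -
      have "emeasure (completion M) A \<le> emeasure (completion M) (qball (space M) d x (R * r))"
        using A sets_qball[OF x] by (intro emeasure_mono) auto
      also have "\<dots> = ennreal (measure M (qball (space M) d x (R * r)))"
        using sets_qball[OF x] emeasure_qball_finite[OF x, of "R * r"] \<open>0 < R\<close> r
        by (simp add: emeasure_eq_ennreal_measure)
      also have "measure M (qball (space M) d x (R * r)) \<le> E * (b * \<phi> r)"
        using \<phi>[OF x r] \<open>0 < E\<close> by (intro order_trans[OF E[OF x r]] mult_left_mono) auto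
      finally show ?thesis by (simp add: ennreal_leI mult.assoc)
    qed
    show "amalgam_norm_at M d q p \<alpha> r f \<le> ennreal (C * w)"
      using slice[OF _ sup(1)] slice[OF _ sup(2)] \<phi>[OF _ r]
      by (intro C[OF f \<phi>_pos[OF r] _ G sub]) auto
  qed
qed

theorem theorem2p11:
  fixes M :: "'a measure" and d :: "'a \<Rightarrow> 'a \<Rightarrow> real"
    and q \<alpha> :: real and p :: ennreal
    and \<phi> :: "real \<Rightarrow> real" and a b :: real
  assumes "homogeneous_type_space M d"
    and "1 \<le> q" and "q < \<alpha>" and "ennreal \<alpha> < p" and "p \<le> \<infinity>"
    and "mono_on {0..} \<phi>"
    and "0 < a" and "a \<le> b"
    and "\<And>x r. x \<in> space M \<Longrightarrow> 0 < r \<Longrightarrow>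
           a * \<phi> r \<le> measure M (qball (space M) d x r) \<and>
           measure M (qball (space M) d x r) \<le> b * \<phi> r"
  shows "\<exists>C::real. C > 0 \<and>
           (\<forall>f\<in>L0 M. amalgam_norm M d q p \<alpha> f \<le> ennreal C * weak_norm M \<alpha> f)"
proof -
  interpret homogeneous_type_space M d by fact
  obtain C where "0 < C" and C: "\<And>f w r. f \<in> L0 M \<Longrightarrow> 0 < w \<Longrightarrow> weak_norm M \<alpha> f \<le> ennreal w \<Longrightarrow>
      0 < r \<Longrightarrow> amalgam_norm_at M d q p \<alpha> r f \<le> ennreal (C * w)"
  proof (rule amalgam_norm_at_le_weak[OF _ assms(3,4,7) _ assms(9)])
    show "0 < q" "0 < b" using assms by auto
  qed (use assms in auto)
  have "amalgam_norm M d q p \<alpha> f \<le> ennreal C * weak_norm M \<alpha> f" if f: "f \<in> L0 M" for f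
  proof (cases "weak_norm M \<alpha> f")
    case (real W)
    have "amalgam_norm M d q p \<alpha> f \<le> ennreal (C * W)"
    proof (rule ennreal_le_epsilon)
      \<comment> \<open>The bounds above require \<open>w > 0\<close>, while the weak norm may vanish; hence a bound slightly larger
        than the weak norm is used.\<close>
      fix \<epsilon> :: real assume "0 < \<epsilon>"
      then have "0 < W + \<epsilon> / C" using real \<open>0 < C\<close> by (simp add: add_nonneg_pos)
      moreover have "weak_norm M \<alpha> f \<le> ennreal (W + \<epsilon> / C)"
        using real \<open>0 < \<epsilon>\<close> \<open>0 < C\<close> by (auto intro!: ennreal_leI)
      ultimately have "amalgam_norm M d q p \<alpha> f \<le> ennreal (C * (W + \<epsilon> / C))"
        unfolding amalgam_norm_def by (intro SUP_least C f) auto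
      also have "C * (W + \<epsilon> / C) = C * W + \<epsilon>" using \<open>0 < C\<close> by (simp add: distrib_left)
      finally show "amalgam_norm M d q p \<alpha> f \<le> ennreal (C * W) + ennreal \<epsilon>"
        using real \<open>0 < C\<close> \<open>0 < \<epsilon>\<close> by (simp flip: ennreal_plus)
    qed
    then show ?thesis using real \<open>0 < C\<close> by (simp add: ennreal_mult)
  next
    case top
    with \<open>0 < C\<close> show ?thesis by (simp add: ennreal_mult_top)
  qed
  with \<open>0 < C\<close> show ?thesis by blast
qed

end
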